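(* Let $G$ be a finite group, let $\mathbb{D}\in\{\mathbb{R},\mathbb{C},\mathbb{H}\}$, and let $\pi$ be an irreducible real representation of $G$ with $\mathrm{End}_G(\pi)\cong\mathbb{D}$. Let $U=\sum_{g\in G}g^2\in Z(\mathbb{R}[G])$. Then the trace of the action of $U$ on $\pi$ equals $$\mathrm{Tr}_\pi(U)=(2-\dim_{\mathbb{R}}\mathbb{D})\,|G|.$$
   Context: Representations are finite-dimensional; the trace is the trace of a real-linear operator on the real vector space $\pi$. *)

theory Defs
  imports "HOL-Analysis.Analysis" "HOL-Algebra.Ring"
begin

section \<open>The quaternions as a real algebra\<close>

datatype quaternion = Quaternion (q_re: real) (q_i: real) (q_j: real) (q_k: real)

lemma quaternion_eq_iff:
  "x = y \<longleftrightarrow> q_re x = q_re y \<and> q_i x = q_i y \<and> q_j x = q_j y \<and> q_k x = q_k y"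
  by (cases x; cases y) simp

instantiation quaternion :: real_algebra_1
begin

definition "0 = Quaternion 0 0 0 0"

definition "1 = Quaternion 1 0 0 0"

definition "x + y = Quaternion (q_re x + q_re y) (q_i x + q_i y) (q_j x + q_j y) (q_k x + q_k y)"

definition "- x = Quaternion (- q_re x) (- q_i x) (- q_j x) (- q_k x)"

definition "x - y = Quaternion (q_re x - q_re y) (q_i x - q_i y) (q_j x - q_j y) (q_k x - q_k y)"

definition "r *\<^sub>R x = Quaternion (r * q_re x) (r * q_i x) (r * q_j x) (r * q_k x)"

definition "x * y = Quaternion
  (q_re x * q_re y - q_i x * q_i y - q_j x * q_j y - q_k x * q_k y)
  (q_re x * q_i y + q_i x * q_re y + q_j x * q_k y - q_k x * q_j y)
  (q_re x * q_j y - q_i x * q_k y + q_j x * q_re y + q_k x * q_i y)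
  (q_re x * q_k y + q_i x * q_j y - q_j x * q_i y + q_k x * q_re y)"

instance
  by standard
    (simp_all add: quaternion_eq_iff zero_quaternion_def one_quaternion_def plus_quaternion_def
      uminus_quaternion_def minus_quaternion_def scaleR_quaternion_def times_quaternion_def
      algebra_simps)

end

lemma dim_quaternion: "dim (UNIV :: quaternion set) = 4"
proof -
  let ?B = "{Quaternion 1 0 0 0, Quaternion 0 1 0 0, Quaternion 0 0 1 0, Quaternion 0 0 0 1}"
  note qdefs = zero_quaternion_def plus_quaternion_def scaleR_quaternion_def
  have sp: "x \<in> span ?B" for x :: quaternion
  proof -
    have "x = q_re x *\<^sub>R Quaternion 1 0 0 0 + q_i x *\<^sub>R Quaternion 0 1 0 0
        + q_j x *\<^sub>R Quaternion 0 0 1 0 + q_k x *\<^sub>R Quaternion 0 0 0 1"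
      by (simp add: qdefs)
    also have "\<dots> \<in> span ?B"
      by (intro span_add span_scale span_base) auto
    finally show ?thesis .
  qed
  have "independent ?B"
    by (rule independent_if_scalars_zero) (auto simp: qdefs)
  then have "dim (UNIV :: quaternion set) = card ?B"
    using sp by (intro dim_unique[of ?B]) auto
  then show ?thesis by simp
qed

section \<open>The trace of a real-linear operator\<close>

definition finite_dimensional :: "'v::real_vector itself \<Rightarrow> bool" where
  "finite_dimensional _ \<longleftrightarrow> (\<exists>B :: 'v set. finite B \<and> span B = UNIV)"

text \<open>The value does not depend on the basis; see \<open>operator_trace_eq\<close> below.\<close>

definition operator_trace :: "('v::real_vector \<Rightarrow> 'v) \<Rightarrow> real" where
  "operator_trace f =
    (let B = (SOME B. independent B \<and> span B = UNIV) in \<Sum>b\<in>B. representation B (f b) b)"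

lemma trace_sum_eq:
  fixes f :: "'v::real_vector \<Rightarrow> 'v"
  assumes f: "linear f"
    and B: "independent B" "span B = UNIV" "finite B"
    and C: "independent C" "span C = UNIV" "finite C"
  shows "(\<Sum>b\<in>B. representation B (f b) b) = (\<Sum>c\<in>C. representation C (f c) c)"
proof -
  have expand: "(\<Sum>d\<in>D. representation D v d *\<^sub>R d) = v"
    if "independent D" "span D = UNIV" "finite D" for D and v :: 'v
    using that by (intro real_vector.sum_representation_eq) auto
  have lin: "representation D (\<Sum>d\<in>E. r d *\<^sub>R w d) x = (\<Sum>d\<in>E. r d * representation D (w d) x)"
    if "independent D" "span D = UNIV" for D E x r and w :: "'v \<Rightarrow> 'v"
    using that by (simp add: real_vector.representation_sum real_vector.representation_scale)
  have "(\<Sum>b\<in>B. representation B (f b) b)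
      = (\<Sum>b\<in>B. \<Sum>c\<in>C. representation C b c * representation B (f c) b)"
  proof (rule sum.cong[OF refl])
    fix b assume "b \<in> B"
    have "f b = f (\<Sum>c\<in>C. representation C b c *\<^sub>R c)"
      by (simp add: expand[OF C])
    also have "\<dots> = (\<Sum>c\<in>C. representation C b c *\<^sub>R f c)"
      using f by (simp add: linear_sum linear_scale)
    finally show "representation B (f b) b = (\<Sum>c\<in>C. representation C b c * representation B (f c) b)"
      by (simp add: lin B)
  qed
  also have "\<dots> = (\<Sum>c\<in>C. \<Sum>b\<in>B. representation B (f c) b * representation C b c)"
    by (subst sum.swap) (simp add: mult.commute)
  also have "\<dots> = (\<Sum>c\<in>C. representation C (f c) c)"
  proof (rule sum.cong[OF refl])
    fix c assume "c \<in> C"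
    have "representation C (f c) c = representation C (\<Sum>b\<in>B. representation B (f c) b *\<^sub>R b) c"
      by (simp add: expand[OF B])
    then show "(\<Sum>b\<in>B. representation B (f c) b * representation C b c) = representation C (f c) c"
      by (simp add: lin C)
  qed
  finally show ?thesis .
qed

lemma operator_trace_eq:
  fixes f :: "'v::real_vector \<Rightarrow> 'v"
  assumes f: "linear f" and B: "independent B" "span B = UNIV" "finite B"
  shows "operator_trace f = (\<Sum>b\<in>B. representation B (f b) b)"
proof -
  define C :: "'v set" where "C = (SOME B. independent B \<and> span B = UNIV)"
  have C: "independent C \<and> span C = UNIV"
    unfolding C_def using B by (rule_tac someI[of _ B]) auto
  have "finite C"
    using real_vector.independent_span_bound[of B C] B C by auto
  then show ?thesis
    using trace_sum_eq[OF f _ _ _ B, of C] C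
    by (simp add: operator_trace_def Let_def C_def[symmetric])
qed

section \<open>The real group algebra of a finite group\<close>

text \<open>Elements are coefficient functions vanishing off the carrier, multiplied by convolution.
  No finite-support condition is imposed, so this is \<open>\<real>[G]\<close> only for finite \<open>G\<close>.\<close>

definition group_algebra :: "('g, 'm) monoid_scheme \<Rightarrow> ('g \<Rightarrow> real) ring" where
  "group_algebra G = \<lparr>
     carrier = {a. \<forall>x. x \<notin> carrier G \<longrightarrow> a x = 0},
     monoid.mult = (\<lambda>a b x. if x \<in> carrier G
        then \<Sum>g\<in>carrier G. a g * b (inv\<^bsub>G\<^esub> g \<otimes>\<^bsub>G\<^esub> x) else 0),
     one = (\<lambda>x. if x = \<one>\<^bsub>G\<^esub> then 1 else 0),
     zero = (\<lambda>x. 0),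
     add = (\<lambda>a b x. a x + b x)\<rparr>"

definition group_elem :: "'g \<Rightarrow> 'g \<Rightarrow> real" where
  "group_elem g = (\<lambda>x. if x = g then 1 else 0)"

definition ring_center :: "('a, 'm) ring_scheme \<Rightarrow> 'a set" where
  "ring_center R = {z \<in> carrier R. \<forall>a \<in> carrier R. z \<otimes>\<^bsub>R\<^esub> a = a \<otimes>\<^bsub>R\<^esub> z}"

definition square_sum :: "('g, 'm) monoid_scheme \<Rightarrow> 'g \<Rightarrow> real" where
  "square_sum G = finsum (group_algebra G) (\<lambda>g. group_elem (g [^]\<^bsub>G\<^esub> (2::nat))) (carrier G)"

lemma group_algebra_ring:
  assumes "group G" "finite (carrier G)"
  shows "ring (group_algebra G)"
proof -
  interpret group G by fact
  note [simp] = group_algebra_def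
  have ag: "abelian_group (group_algebra G)"
  proof (rule abelian_groupI)
    fix a assume "a \<in> carrier (group_algebra G)"
    then show "\<exists>b\<in>carrier (group_algebra G). b \<oplus>\<^bsub>group_algebra G\<^esub> a = \<zero>\<^bsub>group_algebra G\<^esub>"
      by (intro bexI[of _ "\<lambda>x. - a x"]) auto
  qed (auto simp: algebra_simps)
  have bij: "bij_betw (\<lambda>k. g \<otimes>\<^bsub>G\<^esub> k) (carrier G) (carrier G)" if "g \<in> carrier G" for g
    using that by (intro bij_betw_byWitness[where f' = "\<lambda>k. inv\<^bsub>G\<^esub> g \<otimes>\<^bsub>G\<^esub> k"])
      (auto simp: m_assoc[symmetric])
  have assoc: "(a \<otimes>\<^bsub>group_algebra G\<^esub> b) \<otimes>\<^bsub>group_algebra G\<^esub> c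
      = a \<otimes>\<^bsub>group_algebra G\<^esub> (b \<otimes>\<^bsub>group_algebra G\<^esub> c)" for a b c
  proof
    fix x
    show "((a \<otimes>\<^bsub>group_algebra G\<^esub> b) \<otimes>\<^bsub>group_algebra G\<^esub> c) x
      = (a \<otimes>\<^bsub>group_algebra G\<^esub> (b \<otimes>\<^bsub>group_algebra G\<^esub> c)) x"
    proof (cases "x \<in> carrier G")
      case x: True
      have "(\<Sum>h\<in>carrier G. (\<Sum>g\<in>carrier G. a g * b (inv\<^bsub>G\<^esub> g \<otimes>\<^bsub>G\<^esub> h)) * c (inv\<^bsub>G\<^esub> h \<otimes>\<^bsub>G\<^esub> x))
          = (\<Sum>g\<in>carrier G. \<Sum>h\<in>carrier G. a g * b (inv\<^bsub>G\<^esub> g \<otimes>\<^bsub>G\<^esub> h) * c (inv\<^bsub>G\<^esub> h \<otimes>\<^bsub>G\<^esub> x))"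
        by (subst sum.swap) (simp add: sum_distrib_right)
      also have "\<dots> = (\<Sum>g\<in>carrier G. \<Sum>k\<in>carrier G. a g * b k * c (inv\<^bsub>G\<^esub> k \<otimes>\<^bsub>G\<^esub> (inv\<^bsub>G\<^esub> g \<otimes>\<^bsub>G\<^esub> x)))"
      proof (rule sum.cong[OF refl])
        fix g assume g: "g \<in> carrier G"
        show "(\<Sum>h\<in>carrier G. a g * b (inv\<^bsub>G\<^esub> g \<otimes>\<^bsub>G\<^esub> h) * c (inv\<^bsub>G\<^esub> h \<otimes>\<^bsub>G\<^esub> x))
          = (\<Sum>k\<in>carrier G. a g * b k * c (inv\<^bsub>G\<^esub> k \<otimes>\<^bsub>G\<^esub> (inv\<^bsub>G\<^esub> g \<otimes>\<^bsub>G\<^esub> x)))"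
          by (subst sum.reindex_bij_betw[OF bij[OF g], symmetric])
            (use g x in \<open>simp add: m_assoc[symmetric] inv_mult_group\<close>)
      qed
      also have "\<dots> = (\<Sum>g\<in>carrier G. a g * (\<Sum>k\<in>carrier G. b k * c (inv\<^bsub>G\<^esub> k \<otimes>\<^bsub>G\<^esub> (inv\<^bsub>G\<^esub> g \<otimes>\<^bsub>G\<^esub> x))))"
        by (simp add: sum_distrib_left mult.assoc)
      finally show ?thesis using x by (simp cong: sum.cong)
    qed simp
  qed
  have left_one: "\<one>\<^bsub>group_algebra G\<^esub> \<otimes>\<^bsub>group_algebra G\<^esub> a = a" if "a \<in> carrier (group_algebra G)" for a
  proof
    fix x
    have "(\<Sum>g\<in>carrier G. (if g = \<one>\<^bsub>G\<^esub> then 1 else 0) * a (inv\<^bsub>G\<^esub> g \<otimes>\<^bsub>G\<^esub> x))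
        = (\<Sum>g\<in>carrier G. if g = \<one>\<^bsub>G\<^esub> then a (inv\<^bsub>G\<^esub> g \<otimes>\<^bsub>G\<^esub> x) else 0)"
      by (rule sum.cong) auto
    then show "(\<one>\<^bsub>group_algebra G\<^esub> \<otimes>\<^bsub>group_algebra G\<^esub> a) x = a x"
      using that assms(2) by auto
  qed
  have right_one: "a \<otimes>\<^bsub>group_algebra G\<^esub> \<one>\<^bsub>group_algebra G\<^esub> = a" if "a \<in> carrier (group_algebra G)" for a
  proof
    fix x
    have "(\<Sum>g\<in>carrier G. a g * (if inv\<^bsub>G\<^esub> g \<otimes>\<^bsub>G\<^esub> x = \<one>\<^bsub>G\<^esub> then 1 else 0))
        = (\<Sum>g\<in>carrier G. if g = x then a g else 0)" if "x \<in> carrier G"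
    proof (rule sum.cong[OF refl])
      fix g assume g: "g \<in> carrier G"
      have "inv\<^bsub>G\<^esub> g \<otimes>\<^bsub>G\<^esub> x = \<one>\<^bsub>G\<^esub> \<longleftrightarrow> g = x"
        by (metis g that inv_closed inv_inv inv_equality l_inv)
      then show "a g * (if inv\<^bsub>G\<^esub> g \<otimes>\<^bsub>G\<^esub> x = \<one>\<^bsub>G\<^esub> then 1 else 0) = (if g = x then a g else 0)"
        by simp
    qed
    then show "(a \<otimes>\<^bsub>group_algebra G\<^esub> \<one>\<^bsub>group_algebra G\<^esub>) x = a x"
      using that assms(2) by auto
  qed
  have "monoid (group_algebra G)"
    using assoc left_one right_one by (intro monoidI) (auto simp del: group_algebra_def, auto)
  then show ?thesis
    using ag by (intro ringI) (auto simp: algebra_simps sum.distrib fun_eq_iff)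
qed

lemma square_sum_apply:
  assumes "group G" "finite (carrier G)"
  shows "square_sum G x = (\<Sum>g\<in>carrier G. group_elem (g [^]\<^bsub>G\<^esub> (2::nat)) x)"
proof -
  interpret group G by fact
  interpret R: ring "group_algebra G" by (rule group_algebra_ring) fact+
  have "finsum (group_algebra G) (\<lambda>g. group_elem (g [^]\<^bsub>G\<^esub> (2::nat))) A x
      = (\<Sum>g\<in>A. group_elem (g [^]\<^bsub>G\<^esub> (2::nat)) x)" if "A \<subseteq> carrier G" for A
    using finite_subset[OF that assms(2)] that
  proof (induction A rule: finite_induct)
    case empty
    then show ?case by (simp only: R.finsum_empty) (simp add: group_algebra_def)
  next
    case (insert y A)
    have "group_elem (g [^]\<^bsub>G\<^esub> (2::nat)) \<in> carrier (group_algebra G)" if "g \<in> carrier G" for g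
      using that nat_pow_closed[of g 2] by (auto simp: group_algebra_def group_elem_def)
    with insert show ?case
      by (subst R.finsum_insert) (auto simp: Pi_iff, auto simp: group_algebra_def)
  qed
  then show ?thesis by (simp add: square_sum_def)
qed

lemma square_sum_central:
  assumes "group G" "finite (carrier G)"
  shows "square_sum G \<in> ring_center (group_algebra G)"
proof -
  interpret group G by fact
  have in_carrier: "square_sum G \<in> carrier (group_algebra G)"
    using nat_pow_closed[of _ 2]
    by (auto simp: square_sum_apply[OF assms] group_algebra_def group_elem_def intro!: sum.neutral)
  have cancel: "inv\<^bsub>G\<^esub> h \<otimes>\<^bsub>G\<^esub> (h \<otimes>\<^bsub>G\<^esub> y) = y" "h \<otimes>\<^bsub>G\<^esub> (inv\<^bsub>G\<^esub> h \<otimes>\<^bsub>G\<^esub> y) = y"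
    if "h \<in> carrier G" "y \<in> carrier G" for h y
    using that by (simp_all add: m_assoc[symmetric])
  have conj_inv: "square_sum G (h \<otimes>\<^bsub>G\<^esub> x \<otimes>\<^bsub>G\<^esub> inv\<^bsub>G\<^esub> h) = square_sum G x"
    if hx: "h \<in> carrier G" "x \<in> carrier G" for h x
  proof -
    have "bij_betw (\<lambda>g. h \<otimes>\<^bsub>G\<^esub> g \<otimes>\<^bsub>G\<^esub> inv\<^bsub>G\<^esub> h) (carrier G) (carrier G)"
      using hx by (intro bij_betw_byWitness[where f' = "\<lambda>g. inv\<^bsub>G\<^esub> h \<otimes>\<^bsub>G\<^esub> g \<otimes>\<^bsub>G\<^esub> h"])
        (auto simp: m_assoc cancel)
    then have "square_sum G (h \<otimes>\<^bsub>G\<^esub> x \<otimes>\<^bsub>G\<^esub> inv\<^bsub>G\<^esub> h) = (\<Sum>g\<in>carrier G.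
        group_elem ((h \<otimes>\<^bsub>G\<^esub> g \<otimes>\<^bsub>G\<^esub> inv\<^bsub>G\<^esub> h) [^]\<^bsub>G\<^esub> (2::nat)) (h \<otimes>\<^bsub>G\<^esub> x \<otimes>\<^bsub>G\<^esub> inv\<^bsub>G\<^esub> h))"
      unfolding square_sum_apply[OF assms] by (rule sum.reindex_bij_betw[symmetric])
    also have "\<dots> = (\<Sum>g\<in>carrier G. group_elem (g [^]\<^bsub>G\<^esub> (2::nat)) x)"
    proof (rule sum.cong[OF refl])
      fix g assume g: "g \<in> carrier G"
      have "(h \<otimes>\<^bsub>G\<^esub> g \<otimes>\<^bsub>G\<^esub> inv\<^bsub>G\<^esub> h) [^]\<^bsub>G\<^esub> (2::nat) = h \<otimes>\<^bsub>G\<^esub> (g [^]\<^bsub>G\<^esub> (2::nat)) \<otimes>\<^bsub>G\<^esub> inv\<^bsub>G\<^esub> h"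
        using g hx by (simp add: numeral_2_eq_2 m_assoc cancel)
      then show "group_elem ((h \<otimes>\<^bsub>G\<^esub> g \<otimes>\<^bsub>G\<^esub> inv\<^bsub>G\<^esub> h) [^]\<^bsub>G\<^esub> (2::nat)) (h \<otimes>\<^bsub>G\<^esub> x \<otimes>\<^bsub>G\<^esub> inv\<^bsub>G\<^esub> h)
          = group_elem (g [^]\<^bsub>G\<^esub> (2::nat)) x"
        using g hx by (simp add: group_elem_def)
    qed
    finally show ?thesis by (simp add: square_sum_apply[OF assms])
  qed
  have "square_sum G \<otimes>\<^bsub>group_algebra G\<^esub> a = a \<otimes>\<^bsub>group_algebra G\<^esub> square_sum G" for a
  proof
    fix x
    have "(\<Sum>g\<in>carrier G. square_sum G g * a (inv\<^bsub>G\<^esub> g \<otimes>\<^bsub>G\<^esub> x))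
        = (\<Sum>g\<in>carrier G. a g * square_sum G (inv\<^bsub>G\<^esub> g \<otimes>\<^bsub>G\<^esub> x))" if x: "x \<in> carrier G"
    proof -
      have "bij_betw (\<lambda>g. x \<otimes>\<^bsub>G\<^esub> inv\<^bsub>G\<^esub> g) (carrier G) (carrier G)"
        using x by (intro bij_betw_byWitness[where f' = "\<lambda>g. inv\<^bsub>G\<^esub> g \<otimes>\<^bsub>G\<^esub> x"])
          (auto simp: inv_mult_group m_assoc cancel)
      then have "(\<Sum>g\<in>carrier G. square_sum G g * a (inv\<^bsub>G\<^esub> g \<otimes>\<^bsub>G\<^esub> x))
          = (\<Sum>g\<in>carrier G. square_sum G (x \<otimes>\<^bsub>G\<^esub> inv\<^bsub>G\<^esub> g) * a (inv\<^bsub>G\<^esub> (x \<otimes>\<^bsub>G\<^esub> inv\<^bsub>G\<^esub> g) \<otimes>\<^bsub>G\<^esub> x))"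
        by (rule sum.reindex_bij_betw[symmetric])
      also have "\<dots> = (\<Sum>g\<in>carrier G. a g * square_sum G (inv\<^bsub>G\<^esub> g \<otimes>\<^bsub>G\<^esub> x))"
      proof (rule sum.cong[OF refl])
        fix g assume g: "g \<in> carrier G"
        have "square_sum G (x \<otimes>\<^bsub>G\<^esub> inv\<^bsub>G\<^esub> g) = square_sum G (inv\<^bsub>G\<^esub> g \<otimes>\<^bsub>G\<^esub> x)"
          using conj_inv[of g "inv\<^bsub>G\<^esub> g \<otimes>\<^bsub>G\<^esub> x"] g x by (simp add: m_assoc[symmetric])
        moreover have "inv\<^bsub>G\<^esub> (x \<otimes>\<^bsub>G\<^esub> inv\<^bsub>G\<^esub> g) \<otimes>\<^bsub>G\<^esub> x = g"
          using g x by (simp add: inv_mult_group m_assoc)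
        ultimately show "square_sum G (x \<otimes>\<^bsub>G\<^esub> inv\<^bsub>G\<^esub> g) * a (inv\<^bsub>G\<^esub> (x \<otimes>\<^bsub>G\<^esub> inv\<^bsub>G\<^esub> g) \<otimes>\<^bsub>G\<^esub> x)
            = a g * square_sum G (inv\<^bsub>G\<^esub> g \<otimes>\<^bsub>G\<^esub> x)"
          by simp
      qed
      finally show ?thesis .
    qed
    then show "(square_sum G \<otimes>\<^bsub>group_algebra G\<^esub> a) x = (a \<otimes>\<^bsub>group_algebra G\<^esub> square_sum G) x"
      by (simp add: group_algebra_def)
  qed
  with in_carrier show ?thesis by (simp add: ring_center_def)
qed

section \<open>Real representations\<close>

definition GL :: "('v::real_vector \<Rightarrow> 'v) monoid" where
  "GL = \<lparr>carrier = {f. linear f \<and> bij f}, monoid.mult = (\<circ>), one = id\<rparr>"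

definition real_representation ::
    "('g, 'm) monoid_scheme \<Rightarrow> ('g \<Rightarrow> 'v::real_vector \<Rightarrow> 'v) \<Rightarrow> bool" where
  "real_representation G \<rho> \<longleftrightarrow> finite_dimensional TYPE('v) \<and> \<rho> \<in> hom G GL"

definition irreducible_representation ::
    "('g, 'm) monoid_scheme \<Rightarrow> ('g \<Rightarrow> 'v::real_vector \<Rightarrow> 'v) \<Rightarrow> bool" where
  "irreducible_representation G \<rho> \<longleftrightarrow>
     real_representation G \<rho> \<and> (UNIV :: 'v set) \<noteq> {0} \<and>
     (\<forall>W. subspace W \<and> (\<forall>g\<in>carrier G. \<rho> g ` W \<subseteq> W) \<longrightarrow> W = {0} \<or> W = UNIV)"

definition group_algebra_action ::
    "('g, 'm) monoid_scheme \<Rightarrow> ('g \<Rightarrow> 'v::real_vector \<Rightarrow> 'v) \<Rightarrow> ('g \<Rightarrow> real) \<Rightarrow> 'v \<Rightarrow> 'v" where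
  "group_algebra_action G \<rho> a = (\<lambda>v. \<Sum>g\<in>carrier G. a g *\<^sub>R \<rho> g v)"

definition End_G ::
    "('g, 'm) monoid_scheme \<Rightarrow> ('g \<Rightarrow> 'v::real_vector \<Rightarrow> 'v) \<Rightarrow> ('v \<Rightarrow> 'v) set" where
  "End_G G \<rho> = {f. linear f \<and> (\<forall>g\<in>carrier G. f \<circ> \<rho> g = \<rho> g \<circ> f)}"

text \<open>Isomorphism of unital real algebras from the type \<open>'d\<close> onto a set of operators, with
  pointwise linear structure and composition as product.\<close>

definition real_algebra_iso ::
    "('d::real_algebra_1 \<Rightarrow> 'v::real_vector \<Rightarrow> 'v) \<Rightarrow> ('v \<Rightarrow> 'v) set \<Rightarrow> bool" where
  "real_algebra_iso \<phi> E \<longleftrightarrow>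
     bij_betw \<phi> UNIV E \<and>
     (\<forall>x y. \<phi> (x + y) = (\<lambda>v. \<phi> x v + \<phi> y v)) \<and>
     (\<forall>r x. \<phi> (r *\<^sub>R x) = (\<lambda>v. r *\<^sub>R \<phi> x v)) \<and>
     (\<forall>x y. \<phi> (x * y) = \<phi> x \<circ> \<phi> y) \<and>
     \<phi> 1 = id"

end

theory Submission
  imports Defs
begin

text \<open>
  Fix a \<open>G\<close>-invariant inner product \<open>q\<close> on the representation space. Taking adjoints with respect
  to \<open>q\<close> is an involution \<open>*\<close> of \<open>End_G\<close>, and the theorem follows from two observations.

  The first is that \<open>Tr(U) / |G|\<close> is the trace of \<open>*\<close> as a linear operator on \<open>End_G\<close>. Morally,
  the average of \<open>\<rho> g \<otimes> \<rho> g\<close> projects \<open>V \<otimes> V\<close>, which \<open>q\<close> identifies with \<open>End V\<close>, onto \<open>End_G\<close>,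
  and composing with the swap of the two factors, which becomes \<open>*\<close>, turns the trace of
  \<open>\<rho> g \<otimes> \<rho> g\<close> into that of \<open>\<rho> g \<circ> \<rho> g\<close>. In coordinates this is Schur orthogonality for real
  matrix coefficients, \<open>schur_orthogonality\<close>, where the right-hand side runs over a
  Hilbert-Schmidt orthonormal basis of \<open>End_G\<close>. If every member of that basis is symmetric or
  skew, then \<open>trace_square_sum_signs\<close> counts it as \<open>+1\<close> or \<open>-1\<close>.

  The second is that the symmetric elements of \<open>End_G\<close> are just the real scalars. In \<open>\<real>\<close>, \<open>\<complex>\<close> and
  the quaternions every \<open>x\<close> satisfies \<open>(x - t)\<^sup>2 = - b\<^sup>2\<close> with \<open>t\<close> the real part and \<open>b\<close> the length of
  the imaginary part. If \<open>x\<close> is symmetric, so is \<open>y = x - t\<close>, and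
  \<open>q (y v) (y v) = q v (y (y v)) = - b\<^sup>2 q v v\<close> forces \<open>y = 0\<close>; this is \<open>symmetric_imp_scalar\<close>.
  Hence \<open>End_G\<close> is the orthogonal sum of the scalars and the skew elements, and the trace of \<open>*\<close> is
  \<open>1 - (dim End_G - 1) = 2 - dim End_G\<close>.
\<close>

section \<open>Inner products on a real vector space\<close>

text \<open>
  The inner product is an explicit function rather than a type class operation, because the
  invariant form on the representation space and the Hilbert-Schmidt form on its commutant are
  constructed inside proofs.
\<close>
locale inner_form =
  fixes q :: "'a::real_vector \<Rightarrow> 'a \<Rightarrow> real"
  assumes add_left: "q (x + y) z = q x z + q y z"
    and scale_left: "q (r *\<^sub>R x) z = r * q x z"
    and sym: "q x y = q y x"
    and pos: "x \<noteq> 0 \<Longrightarrow> q x x > 0"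
begin

lemma linear_left: "linear (\<lambda>x. q x z)"
  by (intro linearI) (simp_all add: add_left scale_left)

lemma linear_right: "linear (q z)"
  unfolding sym[of z] by (rule linear_left)

lemmas form_simps =
  linear_add[OF linear_left] linear_add[OF linear_right]
  linear_diff[OF linear_left] linear_diff[OF linear_right]
  linear_neg[OF linear_left] linear_neg[OF linear_right]
  linear_0[OF linear_left] linear_0[OF linear_right]
  linear_scale[OF linear_left] linear_scale[OF linear_right]
  linear_sum[OF linear_left] linear_sum[OF linear_right]

lemma nonneg: "q x x \<ge> 0"
  using pos[of x] by (cases "x = 0") (auto simp: form_simps)

lemma nondegenerate:
  assumes "\<And>z. q x z = q y z"
  shows "x = y"
  using pos[of "x - y"] assms[of "x - y"] by (auto simp: form_simps)

definition orthonormal :: "'a set \<Rightarrow> bool" where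
  "orthonormal B \<longleftrightarrow> finite B \<and> (\<forall>a\<in>B. \<forall>b\<in>B. q a b = (if a = b then 1 else 0))"

lemma orthonormal_coefficient:
  assumes "orthonormal B" "b \<in> B"
  shows "q b (\<Sum>c\<in>B. r c *\<^sub>R c) = r b"
proof -
  have "q b (\<Sum>c\<in>B. r c *\<^sub>R c) = (\<Sum>c\<in>B. if c = b then r c else 0)"
    unfolding form_simps using assms by (intro sum.cong) (auto simp: orthonormal_def)
  then show ?thesis
    using assms by (simp add: orthonormal_def)
qed

lemma orthonormal_independent:
  assumes "orthonormal B"
  shows "independent B"
proof (rule independent_if_scalars_zero)
  show "finite B" using assms by (simp add: orthonormal_def)
  fix r b assume "(\<Sum>c\<in>B. r c *\<^sub>R c) = 0" "b \<in> B"
  then show "r b = 0"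
    using orthonormal_coefficient[OF assms, of b r] by (simp add: form_simps)
qed

lemma orthonormal_expansion:
  assumes "orthonormal B" "x \<in> span B"
  shows "(\<Sum>b\<in>B. q b x *\<^sub>R b) = x"
proof -
  obtain r where "x = (\<Sum>c\<in>B. r c *\<^sub>R c)"
    using assms by (auto simp: orthonormal_def span_finite)
  then show ?thesis
    using orthonormal_coefficient[OF assms(1), of _ r] by simp
qed

lemma parseval:
  assumes "orthonormal B" "span B = UNIV"
  shows "(\<Sum>b\<in>B. q x b * q b y) = q x y"
proof -
  have "q x y = q x (\<Sum>b\<in>B. q b y *\<^sub>R b)"
    using orthonormal_expansion[OF assms(1), of y] assms(2) by simp
  then show ?thesis by (simp add: form_simps mult.commute)
qed

text \<open>
  Only the span is kept: a vector that already lies in the span of the previous ones contributes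
  nothing, so the given set may be linearly dependent.
\<close>
lemma gram_schmidt:
  assumes "finite A"
  shows "\<exists>B. orthonormal B \<and> span B = span A"
  using assms
proof (induction A rule: finite_induct)
  case empty
  show ?case by (intro exI[of _ "{}"]) (simp add: orthonormal_def)
next
  case (insert a A)
  then obtain B where B: "orthonormal B" "span B = span A" by blast
  define p where "p = (\<Sum>b\<in>B. q b a *\<^sub>R b)"
  have p: "p \<in> span B"
    unfolding p_def by (intro span_sum span_scale span_base)
  have span_a: "span (insert a A) = span (insert a B)"
    by (simp add: span_insert B(2))
  show ?case
  proof (cases "a = p")
    case True
    then have "span (insert a B) = span B"
      using p by (simp add: span_redundant)
    then show ?thesis using B span_a by metis
  next
    case False
    define s where "s = sqrt (q (a - p) (a - p))"
    have s: "s > 0" "s * s = q (a - p) (a - p)"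
      using pos[of "a - p"] False by (simp_all add: s_def)
    define e where "e = (1 / s) *\<^sub>R (a - p)"
    have ee: "q e e = 1"
      using s by (simp add: e_def linear_scale[OF linear_left] linear_scale[OF linear_right] flip: s(2))
    have be: "q b e = 0" "q e b = 0" if "b \<in> B" for b
    proof -
      have "q b p = q b a"
        unfolding p_def by (rule orthonormal_coefficient[OF B(1) that])
      then show "q b e = 0"
        by (simp add: e_def form_simps)
      then show "q e b = 0" by (simp add: sym)
    qed
    have "orthonormal (insert e B)"
      using B(1) ee be by (auto simp: orthonormal_def)
    moreover have "span (insert e B) = span (insert a B)"
    proof (rule span_eq[THEN iffD2], intro conjI insert_subsetI)
      have "a - p \<in> span (insert a B)"
        using p by (meson span_base span_diff span_mono insertI1 subset_insertI subsetD)
      then show "e \<in> span (insert a B)"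
        unfolding e_def by (rule span_scale)
      have "a = s *\<^sub>R e + p"
        using s by (simp add: e_def)
      moreover have "p \<in> span (insert e B)"
        using p by (meson span_mono subset_insertI subsetD)
      ultimately show "a \<in> span (insert e B)"
        by (metis span_add span_base span_scale insertI1)
    qed (auto intro: span_base)
    ultimately show ?thesis using span_a by metis
  qed
qed

lemma orthonormal_basis_exists:
  assumes "subspace S" "finite_dimensional TYPE('a)"
  shows "\<exists>B. orthonormal B \<and> span B = S"
proof -
  obtain C :: "'a set" where C: "finite C" "span C = UNIV"
    using assms(2) by (auto simp: finite_dimensional_def)
  obtain A where A: "A \<subseteq> S" "independent A" "S \<subseteq> span A" "card A = dim S"
    by (rule basis_exists)
  have "finite A"
    using real_vector.independent_span_bound[of C A] A C by auto
  moreover have "span A = S"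
    using A assms(1) by (simp add: span_minimal subset_antisym)
  ultimately show ?thesis using gram_schmidt by metis
qed

lemma operator_trace_orthonormal:
  assumes "linear f" "orthonormal B" "span B = UNIV"
  shows "operator_trace f = (\<Sum>b\<in>B. q b (f b))"
proof -
  have B: "independent B" "finite B"
    using assms orthonormal_independent by (auto simp: orthonormal_def)
  have "representation B x b = q b x" if "b \<in> B" for x b
  proof -
    have "(\<Sum>c\<in>B. representation B x c *\<^sub>R c) = x"
      using B assms(3) by (intro real_vector.sum_representation_eq) auto
    then show ?thesis
      using orthonormal_coefficient[OF assms(2) that, of "representation B x"] by simp
  qed
  then show ?thesis
    using operator_trace_eq[OF assms(1) B(1) assms(3) B(2)] by simp
qed

text \<open>The Riesz representation of \<open>\<lambda>y. q x (f y)\<close>, written out in an orthonormal basis.\<close>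
lemma adjoint_exists:
  assumes "linear f" "orthonormal B" "span B = UNIV"
  obtains f' where "linear f'" "\<And>x y. q (f' x) y = q x (f y)"
proof
  define f' where "f' x = (\<Sum>b\<in>B. q x (f b) *\<^sub>R b)" for x
  show "linear f'"
    by (intro linearI)
      (simp_all add: f'_def form_simps scaleR_add_left sum.distrib scaleR_sum_right)
  fix x y
  have "f y = (\<Sum>b\<in>B. q b y *\<^sub>R f b)"
    using arg_cong[OF orthonormal_expansion[OF assms(2), of y], of f] assms(1,3)
    by (simp add: linear_sum linear_scale)
  then show "q (f' x) y = q x (f y)"
    by (simp add: f'_def form_simps mult.commute)
qed

end

text \<open>The form that makes a chosen basis orthonormal.\<close>
lemma inner_form_exists:
  assumes "finite_dimensional TYPE('a::real_vector)"
  shows "\<exists>q :: 'a \<Rightarrow> 'a \<Rightarrow> real. inner_form q"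
proof -
  obtain C :: "'a set" where C: "finite C" "span C = UNIV"
    using assms by (auto simp: finite_dimensional_def)
  obtain B :: "'a set" where B: "independent B" "UNIV \<subseteq> span B"
    using maximal_independent_subset[of "UNIV :: 'a set"] by metis
  have fin: "finite B"
    using real_vector.independent_span_bound[of C B] B C by auto
  have sp: "span B = UNIV" using B by auto
  let ?q = "\<lambda>x y. \<Sum>b\<in>B. representation B x b * representation B y b"
  have "inner_form ?q"
  proof
    fix x :: 'a assume "x \<noteq> 0"
    have "(\<Sum>b\<in>B. representation B x b *\<^sub>R b) = x"
      using B fin sp by (intro real_vector.sum_representation_eq) auto
    then obtain b where "b \<in> B" "representation B x b \<noteq> 0"
      using \<open>x \<noteq> 0\<close> by (metis (no_types, lifting) scale_zero_left sum.neutral)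
    then show "?q x x > 0"
      using fin by (intro sum_pos2[of _ b]) (auto simp: zero_less_mult_iff)
  qed (use B sp in \<open>simp_all add: real_vector.representation_add real_vector.representation_scale
        algebra_simps sum.distrib sum_distrib_left\<close>)
  then show ?thesis by blast
qed

section \<open>Invariant inner products and matrix coefficients\<close>

lemma representation_simps:
  assumes "real_representation G \<rho>" "group G"
  shows representation_linear: "g \<in> carrier G \<Longrightarrow> linear (\<rho> g)"
    and representation_mult:
      "g \<in> carrier G \<Longrightarrow> h \<in> carrier G \<Longrightarrow> \<rho> (g \<otimes>\<^bsub>G\<^esub> h) v = \<rho> g (\<rho> h v)"
    and representation_one: "\<rho> \<one>\<^bsub>G\<^esub> v = v"
proof -
  interpret group G by fact
  have hom: "\<rho> \<in> hom G GL" using assms(1) by (simp add: real_representation_def)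
  show lin: "linear (\<rho> g)" if "g \<in> carrier G" for g
    using hom that by (auto simp: hom_def GL_def)
  show mult: "\<rho> (g \<otimes>\<^bsub>G\<^esub> h) v = \<rho> g (\<rho> h v)" if "g \<in> carrier G" "h \<in> carrier G" for g h v
    using hom that by (auto simp: hom_def GL_def)
  have "inj (\<rho> \<one>\<^bsub>G\<^esub>)" using hom by (auto simp: hom_def GL_def bij_def)
  moreover have "\<rho> \<one>\<^bsub>G\<^esub> (\<rho> \<one>\<^bsub>G\<^esub> v) = \<rho> \<one>\<^bsub>G\<^esub> v" using mult[of "\<one>\<^bsub>G\<^esub>" "\<one>\<^bsub>G\<^esub>" v] by simp
  ultimately show "\<rho> \<one>\<^bsub>G\<^esub> v = v" by (simp add: inj_eq)
qed

lemma (in group) bij_betw_right_translation: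
  assumes "h \<in> carrier G"
  shows "bij_betw (\<lambda>g. g \<otimes> h) (carrier G) (carrier G)"
  using assms
  by (intro bij_betw_byWitness[where f' = "\<lambda>g. g \<otimes> inv h"]) (auto simp: m_assoc)

lemma (in group) bij_betw_left_translation:
  assumes "h \<in> carrier G"
  shows "bij_betw (\<lambda>g. h \<otimes> g) (carrier G) (carrier G)"
  using assms
  by (intro bij_betw_byWitness[where f' = "\<lambda>g. inv h \<otimes> g"]) (auto simp: m_assoc[symmetric])

text \<open>
  Weyl's averaging: the sum of the pullbacks of any inner product along the group is invariant,
  and it stays positive because the summand of the neutral element is.
\<close>
lemma invariant_inner_form_exists:
  fixes G :: "('g, 'm) monoid_scheme" and \<rho> :: "'g \<Rightarrow> 'v::real_vector \<Rightarrow> 'v"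
  assumes "group G" "finite (carrier G)" "real_representation G \<rho>"
  shows "\<exists>q. inner_form q \<and> (\<forall>g\<in>carrier G. \<forall>x y. q (\<rho> g x) (\<rho> g y) = q x y)"
proof -
  interpret group G by fact
  note rep = representation_simps[OF assms(3,1)]
  obtain q0 :: "'v \<Rightarrow> 'v \<Rightarrow> real" where "inner_form q0"
    using assms(3) inner_form_exists by (auto simp: real_representation_def)
  then interpret q0: inner_form q0 .
  define q where "q x y = (\<Sum>g\<in>carrier G. q0 (\<rho> g x) (\<rho> g y))" for x y
  have "inner_form q"
  proof
    fix x :: 'v assume "x \<noteq> 0"
    show "q x x > 0"
      unfolding q_def
      using assms(2) q0.pos[OF \<open>x \<noteq> 0\<close>] rep(3)[of x]
      by (intro sum_pos2[of _ "\<one>\<^bsub>G\<^esub>"]) (auto simp: q0.nonneg)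
  next
    show "q x y = q y x" for x y by (simp add: q_def q0.sym)
  qed (simp_all add: q_def rep(1) linear_add linear_scale q0.add_left q0.scale_left
        sum.distrib sum_distrib_left)
  moreover have "q (\<rho> h x) (\<rho> h y) = q x y" if "h \<in> carrier G" for h x y
    using sum.reindex_bij_betw[OF bij_betw_right_translation[OF that],
        of "\<lambda>g. q0 (\<rho> g x) (\<rho> g y)"] that
    by (simp add: q_def rep(2))
  ultimately show ?thesis by blast
qed

locale orthogonal_representation = inner_form q + group G
  for G :: "('g, 'm) monoid_scheme" (structure)
    and q :: "'v::real_vector \<Rightarrow> 'v \<Rightarrow> real" +
  fixes \<rho> :: "'g \<Rightarrow> 'v \<Rightarrow> 'v" and E :: "'v set"
  assumes finite_group: "finite (carrier G)"
    and rep: "real_representation G \<rho>"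
    and invariant: "g \<in> carrier G \<Longrightarrow> q (\<rho> g x) (\<rho> g y) = q x y"
    and E: "orthonormal E" "span E = UNIV"
begin

lemmas rep_linear = representation_linear[OF rep is_group]
lemmas rep_mult = representation_mult[OF rep is_group]
lemmas rep_one = representation_one[OF rep is_group]

lemma rep_inv [simp]:
  assumes "g \<in> carrier G"
  shows "\<rho> (inv g) (\<rho> g v) = v" "\<rho> g (\<rho> (inv g) v) = v"
  using assms by (simp_all flip: rep_mult add: rep_one)

lemma rep_adjoint:
  assumes "g \<in> carrier G"
  shows "q (\<rho> g x) y = q x (\<rho> (inv g) y)"
  using invariant[OF assms, of x "\<rho> (inv g) y"] assms by simp

text \<open>
  With \<open>M\<close> the matrix of \<open>\<rho> g\<close> in the orthonormal basis, the trace of \<open>M\<^sup>2\<close> is the sum of the products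
  \<open>M f e * M e f\<close>. Taking the sum over \<open>g\<close> innermost leaves sums of products of two matrix
  coefficients, which Schur orthogonality evaluates.
\<close>
lemma trace_square_sum:
  "operator_trace (group_algebra_action G \<rho> (square_sum G))
     = (\<Sum>e\<in>E. \<Sum>f\<in>E. \<Sum>g\<in>carrier G. q (\<rho> g e) f * q e (\<rho> g f))"
proof -
  have action: "group_algebra_action G \<rho> (square_sum G) v = (\<Sum>g\<in>carrier G. \<rho> g (\<rho> g v))" for v
  proof -
    have "group_algebra_action G \<rho> (square_sum G) v
        = (\<Sum>g\<in>carrier G. \<Sum>x\<in>carrier G. group_elem (g [^] (2::nat)) x *\<^sub>R \<rho> x v)"
      unfolding group_algebra_action_def square_sum_apply[OF is_group finite_group]
      by (simp add: scaleR_sum_left) (rule sum.swap)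
    also have "\<dots> = (\<Sum>g\<in>carrier G. \<rho> g (\<rho> g v))"
    proof (rule sum.cong[OF refl])
      fix g assume g: "g \<in> carrier G"
      have "(\<Sum>x\<in>carrier G. group_elem (g [^] (2::nat)) x *\<^sub>R \<rho> x v)
          = (\<Sum>x\<in>carrier G. if x = g [^] (2::nat) then \<rho> x v else 0)"
        by (intro sum.cong) (auto simp: group_elem_def)
      also have "\<dots> = \<rho> (g [^] (2::nat)) v"
        using g finite_group by simp
      also have "\<dots> = \<rho> g (\<rho> g v)"
        using g by (simp add: numeral_2_eq_2 rep_mult)
      finally show "(\<Sum>x\<in>carrier G. group_elem (g [^] (2::nat)) x *\<^sub>R \<rho> x v) = \<rho> g (\<rho> g v)" .
    qed
    finally show ?thesis .
  qed
  have "linear (group_algebra_action G \<rho> (square_sum G))"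
    unfolding action
    by (intro linear_compose_sum ballI linear_compose[of "\<rho> _" "\<rho> _", unfolded o_def] rep_linear)
  then have "operator_trace (group_algebra_action G \<rho> (square_sum G))
      = (\<Sum>e\<in>E. \<Sum>g\<in>carrier G. q e (\<rho> g (\<rho> g e)))"
    by (simp add: operator_trace_orthonormal[OF _ E] action form_simps)
  also have "\<dots> = (\<Sum>e\<in>E. \<Sum>g\<in>carrier G. \<Sum>f\<in>E. q (\<rho> g e) f * q e (\<rho> g f))"
  proof (intro sum.cong refl)
    fix e g assume "g \<in> carrier G"
    then have "q e (\<rho> g v) = q (\<rho> (inv g) e) v" for v
      by (simp add: rep_adjoint)
    then show "q e (\<rho> g (\<rho> g e)) = (\<Sum>f\<in>E. q (\<rho> g e) f * q e (\<rho> g f))"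
      using parseval[OF E, of "\<rho> (inv g) e" "\<rho> g e"] by (simp add: sym mult.commute)
  qed
  also have "\<dots> = (\<Sum>e\<in>E. \<Sum>f\<in>E. \<Sum>g\<in>carrier G. q (\<rho> g e) f * q e (\<rho> g f))"
    by (intro sum.cong refl sum.swap)
  finally show ?thesis .
qed

lemma adjoint_in_End_G:
  assumes "f \<in> End_G G \<rho>"
  obtains f' where "f' \<in> End_G G \<rho>" "\<And>x y. q (f' x) y = q x (f y)"
proof -
  have f: "linear f" "\<And>g v. g \<in> carrier G \<Longrightarrow> f (\<rho> g v) = \<rho> g (f v)"
    using assms by (auto simp: End_G_def fun_eq_iff)
  obtain f' where f': "linear f'" "\<And>x y. q (f' x) y = q x (f y)"
    using adjoint_exists[OF f(1) E] by blast
  have "f' (\<rho> g x) = \<rho> g (f' x)" if "g \<in> carrier G" for g x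
    using that by (intro nondegenerate) (simp add: f' rep_adjoint f(2))
  then show thesis
    using that[of f'] f' by (auto simp: End_G_def fun_eq_iff)
qed

text \<open>
  By invariance of \<open>q\<close> this operator is the sum over \<open>g\<close> of the conjugates by \<open>\<rho> g\<close> of the rank-one
  operator \<open>\<lambda>w. q v w *\<^sub>R u\<close>, hence commutes with the group.
\<close>
lemma averaged_rank_one_in_End_G:
  "(\<lambda>w. \<Sum>g\<in>carrier G. q (\<rho> g v) w *\<^sub>R \<rho> g u) \<in> End_G G \<rho>"
proof -
  let ?A = "\<lambda>w. \<Sum>g\<in>carrier G. q (\<rho> g v) w *\<^sub>R \<rho> g u"
  have "linear ?A"
    by (intro linearI) (simp_all add: form_simps scaleR_add_left sum.distrib scaleR_sum_right)
  moreover have "?A (\<rho> h w) = \<rho> h (?A w)" if h: "h \<in> carrier G" for h w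
  proof -
    have "?A (\<rho> h w) = (\<Sum>g\<in>carrier G. q (\<rho> (h \<otimes> g) v) (\<rho> h w) *\<^sub>R \<rho> (h \<otimes> g) u)"
      by (rule sum.reindex_bij_betw[OF bij_betw_left_translation[OF h], symmetric])
    then show ?thesis
      using h by (simp add: rep_mult invariant linear_sum linear_scale rep_linear)
  qed
  ultimately show ?thesis by (auto simp: End_G_def fun_eq_iff)
qed

end

section \<open>The commutant as an algebra with involution\<close>

text \<open>
  The commutant is handled through an algebra \<open>'d\<close> isomorphic to it, since \<open>'d\<close> is a vector space as a
  type, so that spans, dimensions and orthonormal bases make sense for it.
\<close>
locale commutant_model = orthogonal_representation G q \<rho> E
  for G :: "('g, 'm) monoid_scheme" (structure)
    and q :: "'v::real_vector \<Rightarrow> 'v \<Rightarrow> real"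
    and \<rho> :: "'g \<Rightarrow> 'v \<Rightarrow> 'v" and E :: "'v set" +
  fixes \<phi> :: "'d::real_algebra_1 \<Rightarrow> 'v \<Rightarrow> 'v"
  assumes iso: "real_algebra_iso \<phi> (End_G G \<rho>)"
    and nontrivial: "(UNIV :: 'v set) \<noteq> {0}"
begin

lemma phi_simps:
  "\<phi> (x + y) v = \<phi> x v + \<phi> y v"
  "\<phi> (r *\<^sub>R x) v = r *\<^sub>R \<phi> x v"
  "\<phi> (x * y) v = \<phi> x (\<phi> y v)"
  "\<phi> 1 v = v"
  using iso by (auto simp: real_algebra_iso_def)

lemma phi_linear_left: "linear (\<lambda>x. \<phi> x v)"
  by (intro linearI) (simp_all add: phi_simps)

lemmas phi_linear_simps =
  linear_diff[OF phi_linear_left] linear_neg[OF phi_linear_left]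
  linear_0[OF phi_linear_left] linear_sum[OF phi_linear_left]

lemma phi_inject: "\<phi> x = \<phi> y \<longleftrightarrow> x = y"
  using iso by (auto simp: real_algebra_iso_def bij_betw_def inj_eq)

lemma phi_in_End_G: "\<phi> x \<in> End_G G \<rho>"
  using iso by (auto simp: real_algebra_iso_def bij_betw_def)

lemma phi_surj:
  assumes "f \<in> End_G G \<rho>"
  obtains x where "\<phi> x = f"
  using iso assms unfolding real_algebra_iso_def bij_betw_def by (metis imageE)

lemma phi_linear: "linear (\<phi> x)"
  using phi_in_End_G[of x] by (simp add: End_G_def)

lemma phi_commute: "g \<in> carrier G \<Longrightarrow> \<phi> x (\<rho> g v) = \<rho> g (\<phi> x v)"
  using phi_in_End_G[of x] by (auto simp: End_G_def fun_eq_iff)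

text \<open>The Hilbert-Schmidt inner product of operators, pulled back to \<open>'d\<close>.\<close>
definition hs :: "'d \<Rightarrow> 'd \<Rightarrow> real" where
  "hs x y = (\<Sum>e\<in>E. q (\<phi> x e) (\<phi> y e))"

sublocale hs: inner_form hs
proof
  fix x :: 'd assume "x \<noteq> 0"
  then obtain v where v: "\<phi> x v \<noteq> \<phi> 0 v"
    using phi_inject[of x 0] by auto
  have "\<exists>e\<in>E. \<phi> x e \<noteq> 0"
  proof (rule ccontr)
    assume "\<not> ?thesis"
    then have "\<phi> x v = 0"
      using linear_eq_0_on_span[OF phi_linear[of x], of E v] E(2) by auto
    then show False using v by (simp add: phi_linear_simps)
  qed
  then obtain e where "e \<in> E" "\<phi> x e \<noteq> 0" by blast
  then show "hs x x > 0"
    unfolding hs_def using E(1) pos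
    by (intro sum_pos2[of _ e]) (auto simp: orthonormal_def nonneg)
next
  show "hs x y = hs y x" for x y by (simp add: hs_def sym)
qed (simp_all add: hs_def phi_simps add_left scale_left sum.distrib sum_distrib_left)

text \<open>
  The left-hand side is \<open>q p (A w)\<close>, where \<open>A\<close> is the averaged rank-one operator made from \<open>v\<close> and
  \<open>u\<close>. As \<open>A\<close> lies in the commutant, it can be expanded in the basis \<open>B\<close>. Averaging does not
  change the Hilbert-Schmidt product with an element of the commutant, so the coefficient at \<open>b\<close>
  is \<open>|G|\<close> times the product of \<open>\<phi> b\<close> with the rank-one operator itself, namely \<open>q (\<phi> b v) u\<close>.
\<close>
lemma schur_orthogonality:
  assumes "hs.orthonormal B" "span B = UNIV"
  shows "(\<Sum>g\<in>carrier G. q (\<rho> g v) w * q p (\<rho> g u))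
    = real (card (carrier G)) * (\<Sum>b\<in>B. q (\<phi> b v) u * q p (\<phi> b w))"
proof -
  obtain a where a: "\<phi> a = (\<lambda>w. \<Sum>g\<in>carrier G. q (\<rho> g v) w *\<^sub>R \<rho> g u)"
    using phi_surj[OF averaged_rank_one_in_End_G] by blast
  have coeff: "hs b a = real (card (carrier G)) * q (\<phi> b v) u" for b
  proof -
    obtain c where c: "\<And>x y. q (c x) y = q x (\<phi> b y)"
      using adjoint_in_End_G[OF phi_in_End_G[of b]] by blast
    have c': "q (\<phi> b x) y = q x (c y)" for x y
      using c[of y x] by (simp only: sym)
    have "hs b a = (\<Sum>e\<in>E. \<Sum>g\<in>carrier G. q (\<rho> g v) e * q e (c (\<rho> g u)))"
      by (simp add: hs_def a form_simps c')
    also have "\<dots> = (\<Sum>g\<in>carrier G. \<Sum>e\<in>E. q (\<rho> g v) e * q e (c (\<rho> g u)))"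
      by (rule sum.swap)
    also have "\<dots> = (\<Sum>g\<in>carrier G. q (\<phi> b v) u)"
      by (intro sum.cong refl)
        (simp add: parseval[OF E], simp add: phi_commute invariant flip: c')
    finally show ?thesis by simp
  qed
  have "(\<Sum>g\<in>carrier G. q (\<rho> g v) w * q p (\<rho> g u)) = q p (\<phi> a w)"
    by (simp add: a form_simps)
  also have "\<dots> = q p (\<phi> (\<Sum>b\<in>B. hs b a *\<^sub>R b) w)"
    using hs.orthonormal_expansion[OF assms(1), of a] assms(2) by simp
  also have "\<dots> = real (card (carrier G)) * (\<Sum>b\<in>B. q (\<phi> b v) u * q p (\<phi> b w))"
    by (simp add: phi_linear_simps phi_simps form_simps coeff sum_distrib_left mult.assoc)
  finally show ?thesis .
qed

text \<open>
  Schur orthogonality gives \<open>|G|\<close> times the sum over \<open>b\<close> of the trace of \<open>(\<phi> b)\<^sup>2\<close>. As \<open>\<phi> b\<close> is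
  \<open>\<epsilon> b\<close> times its adjoint, that trace is \<open>\<epsilon> b\<close> times the squared Hilbert-Schmidt norm of \<open>b\<close>,
  which is 1.
\<close>
lemma trace_square_sum_signs:
  assumes B: "hs.orthonormal B" "span B = UNIV"
    and \<epsilon>: "\<And>b x y. b \<in> B \<Longrightarrow> q x (\<phi> b y) = \<epsilon> b * q (\<phi> b x) y"
  shows "operator_trace (group_algebra_action G \<rho> (square_sum G))
    = real (card (carrier G)) * (\<Sum>b\<in>B. \<epsilon> b)"
proof -
  have "operator_trace (group_algebra_action G \<rho> (square_sum G))
      = real (card (carrier G)) * (\<Sum>e\<in>E. \<Sum>f\<in>E. \<Sum>b\<in>B. q (\<phi> b e) f * q e (\<phi> b f))"
    by (simp add: trace_square_sum schur_orthogonality[OF B] sum_distrib_left)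
  also have "(\<Sum>e\<in>E. \<Sum>f\<in>E. \<Sum>b\<in>B. q (\<phi> b e) f * q e (\<phi> b f))
      = (\<Sum>e\<in>E. \<Sum>f\<in>E. \<Sum>b\<in>B. \<epsilon> b * (q (\<phi> b e) f * q f (\<phi> b e)))"
  proof (intro sum.cong refl)
    fix e f b assume "b \<in> B"
    then show "q (\<phi> b e) f * q e (\<phi> b f) = \<epsilon> b * (q (\<phi> b e) f * q f (\<phi> b e))"
      using \<epsilon>[of b e f] sym[of "\<phi> b e" f] by simp
  qed
  also have "\<dots> = (\<Sum>e\<in>E. \<Sum>b\<in>B. \<Sum>f\<in>E. \<epsilon> b * (q (\<phi> b e) f * q f (\<phi> b e)))"
    by (intro sum.cong refl sum.swap)
  also have "\<dots> = (\<Sum>e\<in>E. \<Sum>b\<in>B. \<epsilon> b * q (\<phi> b e) (\<phi> b e))"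
    by (simp add: parseval[OF E] flip: sum_distrib_left)
  also have "\<dots> = (\<Sum>b\<in>B. \<epsilon> b * hs b b)"
    by (subst sum.swap) (simp add: hs_def sum_distrib_left)
  also have "\<dots> = (\<Sum>b\<in>B. \<epsilon> b)"
    using B(1) by (intro sum.cong) (auto simp: hs.orthonormal_def)
  finally show ?thesis .
qed

definition skew :: "'d set" where
  "skew = {x. \<forall>u v. q (\<phi> x u) v = - q u (\<phi> x v)}"

lemma subspace_skew: "subspace skew"
  by (auto simp: skew_def subspace_def phi_simps phi_linear_simps form_simps)

text \<open>
  A symmetric operator has a square that is positive semidefinite, so it can equal a nonpositive
  scalar only if the operator vanishes.
\<close>
lemma symmetric_imp_scalar:
  assumes self_adjoint: "\<And>u v. q (\<phi> x u) v = q u (\<phi> x v)"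
    and quadratic: "(x - t *\<^sub>R 1) * (x - t *\<^sub>R 1) = - (b\<^sup>2) *\<^sub>R 1"
  shows "x = t *\<^sub>R 1"
proof -
  let ?y = "x - t *\<^sub>R 1"
  have y: "q (\<phi> ?y u) v = q u (\<phi> ?y v)" for u v
    by (simp add: phi_linear_simps phi_simps(2,4) form_simps self_adjoint)
  have "\<phi> ?y u = 0" for u
  proof (rule ccontr)
    assume "\<phi> ?y u \<noteq> 0"
    have "q (\<phi> ?y u) (\<phi> ?y u) = q u (\<phi> (?y * ?y) u)"
      by (simp only: y phi_simps(3))
    also have "\<dots> = - (b\<^sup>2 * q u u)"
      unfolding quadratic by (simp add: phi_simps phi_linear_simps form_simps)
    also have "\<dots> \<le> 0"
      by (simp add: nonneg)
    finally show False using pos[OF \<open>\<phi> ?y u \<noteq> 0\<close>] by simp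
  qed
  then have "\<phi> ?y = \<phi> 0" by (auto simp: phi_linear_simps)
  then show ?thesis unfolding phi_inject by simp
qed

text \<open>
  For every \<open>x\<close> in the commutant, \<open>x + x*\<close> is symmetric, hence a scalar \<open>t\<close>, and \<open>x - t / 2\<close> is skew.
  Scalars are orthogonal to skew operators because the latter have zero diagonal. So a
  normalised unit together with an orthonormal basis of the skew elements is an orthonormal basis
  with exactly one sign \<open>+1\<close>.
\<close>
theorem trace_square_sum_eq:
  assumes "finite_dimensional TYPE('d)"
    and quadratic: "\<And>x :: 'd. \<exists>t b. (x - t *\<^sub>R 1) * (x - t *\<^sub>R 1) = - (b\<^sup>2) *\<^sub>R 1"
  shows "operator_trace (group_algebra_action G \<rho> (square_sum G))
    = (2 - real (dim (UNIV :: 'd set))) * real (card (carrier G))"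
proof -
  obtain K where K: "hs.orthonormal K" "span K = skew"
    using hs.orthonormal_basis_exists[OF subspace_skew assms(1)] by blast
  have K_skew: "q u (\<phi> x v) = - q (\<phi> x u) v" if "x \<in> K" for x u v
    using K(2) span_base[OF that] by (auto simp: skew_def)
  have hs_one: "hs 1 x = 0" "hs x 1 = 0" if "x \<in> K" for x
  proof -
    have "q u (\<phi> x u) = 0" for u
      using K_skew[OF that, of u u] by (simp add: sym)
    then show "hs 1 x = 0" by (simp add: hs_def phi_simps)
    then show "hs x 1 = 0" by (simp add: hs.sym)
  qed
  define n where "n = hs 1 1"
  obtain v :: 'v where "v \<noteq> 0" using nontrivial by auto
  then have "(1::'d) \<noteq> 0" by simp
  then have n: "n > 0" unfolding n_def by (rule hs.pos)
  \<comment> \<open>Here \<open>n\<close> is the dimension of the representation, the squared Hilbert-Schmidt norm of the unit.\<close>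
  define c :: 'd where "c = (1 / sqrt n) *\<^sub>R 1"
  have cc: "hs c c = 1"
    using n by (simp add: c_def hs.form_simps flip: n_def)
  have cK: "hs c x = 0" "hs x c = 0" if "x \<in> K" for x
    using hs_one[OF that] by (simp_all add: c_def hs.form_simps)
  have "c \<notin> K" using cK cc by force
  have B: "hs.orthonormal (insert c K)"
    using K(1) cc cK by (auto simp: hs.orthonormal_def)
  have "x \<in> span (insert c K)" for x
  proof -
    \<comment> \<open>\<open>y\<close> represents the adjoint of \<open>\<phi> x\<close>.\<close>
    obtain f where f: "f \<in> End_G G \<rho>" "\<And>u v. q (f u) v = q u (\<phi> x v)"
      using adjoint_in_End_G[OF phi_in_End_G[of x]] by blast
    obtain y where y: "\<phi> y = f" using phi_surj[OF f(1)] by blast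
    have adj: "q (\<phi> y u) v = q u (\<phi> x v)" "q (\<phi> x u) v = q u (\<phi> y v)" for u v
      using f(2)[of u v] f(2)[of v u] by (simp_all add: y sym)
    have self_adjoint: "q (\<phi> (x + y) u) v = q u (\<phi> (x + y) v)" for u v
      by (simp add: phi_simps(1) form_simps adj)
    obtain t b where "(x + y - t *\<^sub>R 1) * (x + y - t *\<^sub>R 1) = - (b\<^sup>2) *\<^sub>R 1"
      using quadratic by blast
    then have "x + y = t *\<^sub>R 1"
      by (rule symmetric_imp_scalar[OF self_adjoint])
    then have y_eq: "y = t *\<^sub>R 1 - x" by (simp add: algebra_simps)
    have "x - (t / 2) *\<^sub>R 1 \<in> skew"
      using adj(2) unfolding y_eq by (simp add: skew_def phi_linear_simps phi_simps form_simps)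
    then have "x - (t / 2) *\<^sub>R 1 \<in> span (insert c K)"
      using K(2) span_mono[of K "insert c K"] by blast
    moreover have "(t / 2) *\<^sub>R 1 = (t / 2 * sqrt n) *\<^sub>R c"
      using n by (simp add: c_def)
    then have "(t / 2) *\<^sub>R 1 \<in> span (insert c K)"
      by (metis span_scale span_base insertI1)
    ultimately show ?thesis
      by (metis span_add diff_add_cancel)
  qed
  then have sp: "span (insert c K) = UNIV" by auto
  have finK: "finite K" using K(1) by (simp add: hs.orthonormal_def)
  have "dim (UNIV :: 'd set) = card (insert c K)"
    using hs.orthonormal_independent[OF B] sp by (intro dim_unique) auto
  then have d: "real (dim (UNIV :: 'd set)) = 1 + real (card K)"
    using finK \<open>c \<notin> K\<close> by simp
  let ?\<epsilon> = "\<lambda>b. if b = c then 1 else - 1 :: real"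
  have "operator_trace (group_algebra_action G \<rho> (square_sum G))
      = real (card (carrier G)) * (\<Sum>b\<in>insert c K. ?\<epsilon> b)"
  proof (rule trace_square_sum_signs[OF B sp])
    show "q x (\<phi> b y) = ?\<epsilon> b * q (\<phi> b x) y" if "b \<in> insert c K" for b x y
      using that K_skew[of b x y] by (auto simp: c_def phi_simps form_simps)
  qed
  also have "(\<Sum>b\<in>insert c K. ?\<epsilon> b) = 1 + (\<Sum>b\<in>K. ?\<epsilon> b)"
    using finK \<open>c \<notin> K\<close> by simp
  also have "(\<Sum>b\<in>K. ?\<epsilon> b) = (\<Sum>b\<in>K. - 1)"
    using \<open>c \<notin> K\<close> by (intro sum.cong) auto
  finally show ?thesis by (simp add: d mult.commute)
qed

end

section \<open>The three division algebras\<close>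

text \<open>An infinite basis would have cardinality 0, and \<open>dim\<close> is that cardinality.\<close>
lemma finite_dimensional_if_dim_nonzero:
  assumes "dim (UNIV :: 'a::real_vector set) \<noteq> 0"
  shows "finite_dimensional TYPE('a)"
proof -
  obtain B :: "'a set" 
    where "B \<subseteq> UNIV" "independent B" "UNIV \<subseteq> span B" "card B = dim (UNIV :: 'a set)"
    by (rule basis_exists)
  then show ?thesis
    using assms by (auto simp: finite_dimensional_def intro!: exI[of _ B] card_ge_0_finite)
qed

lemma trace_square_sum_of_quadratic_commutant:
  fixes G :: "('g, 'm) monoid_scheme" and \<rho> :: "'g \<Rightarrow> 'v::real_vector \<Rightarrow> 'v"
    and \<phi> :: "'d::real_algebra_1 \<Rightarrow> 'v \<Rightarrow> 'v"
  assumes "group G" "finite (carrier G)"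
    and rep: "real_representation G \<rho>" and nontrivial: "(UNIV :: 'v set) \<noteq> {0}"
    and iso: "real_algebra_iso \<phi> (End_G G \<rho>)"
    and dim: "dim (UNIV :: 'd set) \<noteq> 0"
    and quadratic: "\<And>x :: 'd. \<exists>t b. (x - t *\<^sub>R 1) * (x - t *\<^sub>R 1) = - (b\<^sup>2) *\<^sub>R 1"
  shows "operator_trace (group_algebra_action G \<rho> (square_sum G))
    = (2 - real (dim (UNIV :: 'd set))) * real (card (carrier G))"
proof -
  obtain q where q: "inner_form q" "\<forall>g\<in>carrier G. \<forall>x y. q (\<rho> g x) (\<rho> g y) = q x y"
    using invariant_inner_form_exists[OF assms(1,2) rep] by blast
  interpret inner_form q by fact
  obtain E where E: "orthonormal E" "span E = UNIV"
    using orthonormal_basis_exists[OF subspace_UNIV] rep by (auto simp: real_representation_def)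
  interpret commutant_model G q \<rho> E \<phi>
    using assms(1,2) iso rep nontrivial q(2) E
    by (intro commutant_model.intro orthogonal_representation.intro q(1)
        orthogonal_representation_axioms.intro commutant_model_axioms.intro) auto
  show ?thesis
    using trace_square_sum_eq[OF finite_dimensional_if_dim_nonzero[OF dim] quadratic] .
qed

text \<open>In each algebra \<open>t\<close> is the real part and \<open>b\<close> is, up to sign, the norm of the imaginary part.\<close>

lemma real_quadratic: "\<exists>t b. (x - t *\<^sub>R 1) * (x - t *\<^sub>R 1) = - (b\<^sup>2) *\<^sub>R (1::real)"
  by (intro exI[of _ x] exI[of _ 0]) simp

lemma complex_quadratic: "\<exists>t b. (x - t *\<^sub>R 1) * (x - t *\<^sub>R 1) = - (b\<^sup>2) *\<^sub>R (1::complex)"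
  by (intro exI[of _ "Re x"] exI[of _ "Im x"]) (simp add: complex_eq_iff power2_eq_square)

lemma quaternion_quadratic: "\<exists>t b. (x - t *\<^sub>R 1) * (x - t *\<^sub>R 1) = - (b\<^sup>2) *\<^sub>R (1::quaternion)"
  by (intro exI[of _ "q_re x"] exI[of _ "sqrt ((q_i x)\<^sup>2 + (q_j x)\<^sup>2 + (q_k x)\<^sup>2)"])
    (simp add: quaternion_eq_iff minus_quaternion_def times_quaternion_def scaleR_quaternion_def
      one_quaternion_def power2_eq_square[of "q_i x"] power2_eq_square[of "q_j x"]
      power2_eq_square[of "q_k x"])

theorem corollary1:
  fixes G :: "('g, 'm) monoid_scheme"
    and \<rho> :: "'g \<Rightarrow> 'v::real_vector \<Rightarrow> 'v"
  assumes "group G"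
    and "finite (carrier G)"
    and "irreducible_representation G \<rho>"
  shows
    "((\<exists>\<phi> :: real \<Rightarrow> 'v \<Rightarrow> 'v. real_algebra_iso \<phi> (End_G G \<rho>)) \<longrightarrow>
        operator_trace (group_algebra_action G \<rho> (square_sum G))
          = (2 - real (dim (UNIV :: real set))) * real (card (carrier G)))
   \<and> ((\<exists>\<phi> :: complex \<Rightarrow> 'v \<Rightarrow> 'v. real_algebra_iso \<phi> (End_G G \<rho>)) \<longrightarrow>
        operator_trace (group_algebra_action G \<rho> (square_sum G))
          = (2 - real (dim (UNIV :: complex set))) * real (card (carrier G)))
   \<and> ((\<exists>\<phi> :: quaternion \<Rightarrow> 'v \<Rightarrow> 'v. real_algebra_iso \<phi> (End_G G \<rho>)) \<longrightarrow>
        operator_trace (group_algebra_action G \<rho> (square_sum G))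
          = (2 - real (dim (UNIV :: quaternion set))) * real (card (carrier G)))"
proof -
  have rep: "real_representation G \<rho>" and nontrivial: "(UNIV :: 'v set) \<noteq> {0}"
    using assms(3) by (auto simp: irreducible_representation_def)
  note trace = trace_square_sum_of_quadratic_commutant[OF assms(1,2) rep nontrivial]
  show ?thesis
    using trace[OF _ _ real_quadratic] trace[OF _ _ complex_quadratic]
      trace[OF _ _ quaternion_quadratic]
    by (auto simp: dim_quaternion)
qed

end
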